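(* Let $\mathcal R_{\mathcal X}$ be the distinguished restriction of a planar vector field $\mathcal X$ with nilpotent linearization at the origin, and suppose that near $u=0$ it has the rational representation $$\mathcal R_{\mathcal X}(u)=u^2\frac{P(u)}{Q(u)},\qquad P(u)=\sum_{j=0}^m p_ju^j,\quad Q(u)=\sum_{j=0}^d q_ju^j,\quad q_0=Q(0)\neq0,$$ with $P,Q$ real polynomials. Write $$\mathcal R_{\mathcal X}(u)=u^2\sum_{n\ge0}c_nu^n=\sum_{k\ge2}g_ku^k,\qquad g_{n+2}=c_n .$$ Then the Taylor coefficients are completely determined by $$q_0c_n+q_1c_{n-1}+\cdots+q_dc_{n-d}=p_n,\qquad n\ge0,$$ where $c_j=0$ for $j<0$ and $p_n=0$ for $n>m$. Equivalently, $$c_n=\frac1{q_0}\Bigl(p_n-\sum_{j=1}^d q_jc_{n-j}\Bigr),\qquad n\ge 0.$$ In particular, for every $n>m$, the sequence satisfies the homogeneous recurrence $$q_0c_n+q_1c_{n-1}+\cdots+q_dc_{n-d}=0.$$ Thus the complete sequence of Taylor coefficients of the distinguished restriction is determined by the finitely many coefficients of $P$ and $Q$.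
   Context: Setting: $\mathcal X$ is a $C^r$ ($r\ge2$) vector field near the origin of $\mathbb R^2$ with $\mathcal X(0)=0$, and $A=D\mathcal X(0)$ satisfies $A\ne0$, $A^2=0$, so $K=\ker A=\operatorname{im}A$ is one-dimensional. For a generator $\mathbf e\neq0$ of $K$, the distinguished restriction is the unique scalar function near $0$ with $A\mathcal X(u\mathbf e)=\mathcal R_{\mathcal X}(u)\mathbf e$. (Here $q_0,\dots,q_d$ denote the coefficients of $Q$.) *)

theory Defs
  imports "HOL-Analysis.Analysis" "HOL-Computational_Algebra.Polynomial"
begin

text \<open>
  \<open>C_diff_on k f U\<close>: the map \<open>f\<close> is of class \<open>C\<^sup>k\<close> on \<open>U\<close> (meant for open \<open>U\<close>), i.e. all
  iterated directional derivatives up to order \<open>k\<close> exist and are continuous. In finite dimension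
  this is the same as continuity of the Frechet derivatives up to order \<open>k\<close>.
\<close>

primrec C_diff_on ::
    "nat \<Rightarrow> ('a::euclidean_space \<Rightarrow> 'b::real_normed_vector) \<Rightarrow> 'a set \<Rightarrow> bool" where
  "C_diff_on 0 f U \<longleftrightarrow> continuous_on U f"
| "C_diff_on (Suc k) f U \<longleftrightarrow>
     (\<forall>x\<in>U. f differentiable (at x)) \<and>
     (\<forall>v. C_diff_on k (\<lambda>x. frechet_derivative f (at x) v) U)"

definition linearization :: "(real^2 \<Rightarrow> real^2) \<Rightarrow> real^2^2" where
  "linearization X = jacobian X (at 0)"

text \<open>
  Only the values of the total function \<open>X\<close> near the origin matter.
\<close>

definition nilpotent_planar_field :: "nat \<Rightarrow> (real^2 \<Rightarrow> real^2) \<Rightarrow> bool" where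
  "nilpotent_planar_field r X \<longleftrightarrow>
     r \<ge> 2 \<and> (\<exists>U. open U \<and> 0 \<in> U \<and> C_diff_on r X U) \<and> X 0 = 0 \<and>
     linearization X \<noteq> 0 \<and> linearization X ** linearization X = 0"

definition kernel_generator :: "(real^2 \<Rightarrow> real^2) \<Rightarrow> real^2 \<Rightarrow> bool" where
  "kernel_generator X e \<longleftrightarrow> e \<noteq> 0 \<and> {v. linearization X *v v = 0} = span {e}"

definition distinguished_restriction ::
    "(real^2 \<Rightarrow> real^2) \<Rightarrow> real^2 \<Rightarrow> real \<Rightarrow> real" where
  "distinguished_restriction X e u =
     (THE s. linearization X *v X (u *\<^sub>R e) = s *\<^sub>R e)"

lemma distinguished_restriction_ex1:
  assumes "nilpotent_planar_field r X" and "kernel_generator X e"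
  shows "\<exists>!s. linearization X *v X (u *\<^sub>R e) = s *\<^sub>R e"
proof -
  let ?A = "linearization X"
  have "?A *v (?A *v X (u *\<^sub>R e)) = 0"
    using assms(1) by (simp add: nilpotent_planar_field_def matrix_vector_mul_assoc)
  then have "?A *v X (u *\<^sub>R e) \<in> span {e}"
    using assms(2) by (auto simp: kernel_generator_def)
  then obtain s where "?A *v X (u *\<^sub>R e) = s *\<^sub>R e"
    by (auto simp: span_singleton)
  moreover have "e \<noteq> 0"
    using assms(2) by (simp add: kernel_generator_def)
  ultimately show ?thesis
    by (auto intro!: ex1I[of _ s])
qed

lemma distinguished_restriction_eq:
  assumes "nilpotent_planar_field r X" and "kernel_generator X e"
  shows "linearization X *v X (u *\<^sub>R e) = distinguished_restriction X e u *\<^sub>R e"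
  unfolding distinguished_restriction_def
  using theI'[OF distinguished_restriction_ex1[OF assms]] .

definition taylor_coeff :: "(real \<Rightarrow> real) \<Rightarrow> nat \<Rightarrow> real" where
  "taylor_coeff f k = (deriv ^^ k) f 0 / fact k"

text \<open>
  Extension of a sequence to integer indices by the convention \<open>a j = 0\<close> for \<open>j < 0\<close>.
\<close>

definition zero_ext :: "(nat \<Rightarrow> real) \<Rightarrow> int \<Rightarrow> real" where
  "zero_ext a j = (if j < 0 then 0 else a (nat j))"

end

theory Submission
  imports Defs
begin

text \<open>
  Near the origin the restriction is the rational function \<open>u\<^sup>2 P(u) / Q(u)\<close>, and a polynomial is
  the sum of its own, finite, power series. Since \<open>Q\<close> has nonzero constant term, it is invertible
  as a formal power series; the inverse series has positive radius of convergence and represents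
  \<open>1 / Q\<close> near \<open>0\<close>. Hence the restriction is represented near \<open>0\<close> by the formal series
  \<open>X\<^sup>2 C\<close> with \<open>C = P / Q\<close>.

  Formal differentiation follows differentiation of the represented function, so the coefficients
  of a representing series are the Taylor coefficients (\<open>taylor_coeff_eq_fps_nth\<close>). This identifies
  \<open>c\<close> with the coefficient sequence of \<open>C\<close> and gives \<open>g 0 = g 1 = 0\<close>, as well as the convergence
  of both series. The Taylor coefficients thus depend on \<open>P\<close> and \<open>Q\<close> alone, which is why another
  field with the same rational representation has the same ones.

  The recurrence for a sequence \<open>a\<close> is the coefficientwise form of the equation \<open>Q A = P\<close> for
  its generating series \<open>A\<close> (\<open>bounded_convolution_eq_fps_nth\<close>). As \<open>Q\<close> is invertible, the only
  solution is \<open>A = P / Q = C\<close> (\<open>recurrence_iff_generating_fps\<close>); this contains both that \<open>c\<close>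
  satisfies the recurrence and that nothing else does. The solved form only isolates the summand
  \<open>j = 0\<close>, and beyond the degree of \<open>P\<close> the right-hand side vanishes.
\<close>

text \<open>
  Formal and analytic differentiation agree, so the iterated derivative at \<open>0\<close> is the constant term
  of the iterated formal derivative. Only the germ of \<open>f\<close> at \<open>0\<close> enters, because representation by
  a power series is itself a local condition.
\<close>

lemma taylor_coeff_eq_fps_nth:
  fixes f :: "real \<Rightarrow> real"
  assumes "f has_fps_expansion F"
  shows "taylor_coeff f n = fps_nth F n"
proof -
  have "(deriv ^^ n) f has_fps_expansion (fps_deriv ^^ n) F"
    by (induction n) (auto intro: assms has_fps_expansion_deriv)
  then have "(deriv ^^ n) f 0 = fps_nth ((fps_deriv ^^ n) F) 0"
    by (auto simp: has_fps_expansion_def eval_fps_at_0 dest: eventually_nhds_x_imp_x)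
  also have "\<dots> = fact n * fps_nth F n"
    by (simp add: fps_0th_higher_deriv)
  finally show ?thesis
    by (simp add: taylor_coeff_def)
qed

lemma has_fps_expansion_poly:
  fixes p :: "real poly"
  shows "poly p has_fps_expansion fps_of_poly p"
proof (rule has_fps_expansionI, rule always_eventually, rule allI)
  fix u :: real
  have "(\<lambda>n. coeff p n * u ^ n) sums (\<Sum>n\<le>degree p. coeff p n * u ^ n)"
    by (rule sums_finite) (auto simp: coeff_eq_0)
  then show "(\<lambda>n. fps_nth (fps_of_poly p) n * u ^ n) sums poly p u"
    by (simp add: poly_altdef)
qed

lemma has_fps_expansion_sums:
  fixes f :: "real \<Rightarrow> real"
  assumes "f has_fps_expansion F"
  shows "\<forall>\<^sub>F u in nhds 0. (\<lambda>n. fps_nth F n * u ^ n) sums f u"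
proof -
  have "\<forall>\<^sub>F u in nhds 0. u \<in> eball 0 (fps_conv_radius F)"
    using assms
    by (intro eventually_nhds_in_open) (auto simp: has_fps_expansion_def zero_ereal_def)
  moreover have "\<forall>\<^sub>F u in nhds 0. eval_fps F u = f u"
    using assms by (simp add: has_fps_expansion_def)
  ultimately show ?thesis
  proof eventually_elim
    case (elim u)
    then show ?case
      using sums_eval_fps[of u F] by simp
  qed
qed

lemma has_fps_expansion_rational:
  fixes P Q :: "real poly"
  assumes "coeff Q 0 \<noteq> 0"
  shows "(\<lambda>u. poly P u / poly Q u) has_fps_expansion fps_of_poly P / fps_of_poly Q"
  using assms by (intro has_fps_expansion_divide' has_fps_expansion_poly) simp

lemma has_fps_expansion_cong_ev:
  assumes "f has_fps_expansion F" and "\<forall>\<^sub>F u in nhds 0. h u = f u"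
  shows "h has_fps_expansion F"
  using assms(1) eventually_elim2[OF _ assms(2), of "\<lambda>u. eval_fps F u = f u"]
  by (auto simp: has_fps_expansion_def)

text \<open>
  The sum over \<open>j \<le> d\<close> and the Cauchy product, which runs over \<open>j \<le> n\<close>, have the same nonzero
  terms: the terms with \<open>j > n\<close> vanish by the convention for negative indices, those with
  \<open>j > d\<close> because they exceed the degree.
\<close>

lemma bounded_convolution_eq_fps_nth:
  assumes "degree Q \<le> d"
  shows "(\<Sum>j\<le>d. coeff Q j * zero_ext a (int n - int j))
    = fps_nth (fps_of_poly Q * Abs_fps a) n"
proof -
  have "(\<Sum>j\<le>d. coeff Q j * zero_ext a (int n - int j))
      = (\<Sum>j\<le>max d n. coeff Q j * zero_ext a (int n - int j))"
    using assms by (intro sum.mono_neutral_left) (auto simp: coeff_eq_0)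
  also have "\<dots> = (\<Sum>j\<le>n. coeff Q j * zero_ext a (int n - int j))"
    by (intro sum.mono_neutral_right) (auto simp: zero_ext_def)
  also have "\<dots> = (\<Sum>j\<le>n. coeff Q j * a (n - j))"
    by (intro sum.cong) (auto simp: zero_ext_def nat_diff_distrib)
  finally show ?thesis
    by (simp add: fps_mult_nth atLeast0AtMost)
qed

text \<open>
  Division by \<open>Q\<close> is legitimate because its constant term is a unit, and it turns the
  recurrence into an explicit formula for its one solution.
\<close>

lemma recurrence_iff_generating_fps:
  fixes P Q :: "real poly"
  assumes "degree Q \<le> d" and "coeff Q 0 \<noteq> 0"
  shows "(\<forall>n. (\<Sum>j\<le>d. coeff Q j * zero_ext a (int n - int j)) = coeff P n)
    \<longleftrightarrow> a = fps_nth (fps_of_poly P / fps_of_poly Q)"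
proof -
  have unit: "fps_nth (fps_of_poly Q) 0 \<noteq> 0"
    using assms(2) by simp
  have "(\<forall>n. (\<Sum>j\<le>d. coeff Q j * zero_ext a (int n - int j)) = coeff P n)
      \<longleftrightarrow> fps_of_poly Q * Abs_fps a = fps_of_poly P"
    by (simp add: bounded_convolution_eq_fps_nth[OF assms(1)] fps_eq_iff)
  also have "\<dots> \<longleftrightarrow> Abs_fps a = fps_of_poly P / fps_of_poly Q"
  proof
    assume "fps_of_poly Q * Abs_fps a = fps_of_poly P"
    then have "fps_of_poly P / fps_of_poly Q
        = Abs_fps a * (inverse (fps_of_poly Q) * fps_of_poly Q)"
      by (simp only: fps_divide_unit[OF unit] ac_simps flip: \<open>_ = fps_of_poly P\<close>)
    then show "Abs_fps a = fps_of_poly P / fps_of_poly Q"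
      by (simp only: inverse_mult_eq_1[OF unit] mult_1_right)
  next
    assume "Abs_fps a = fps_of_poly P / fps_of_poly Q"
    then have "fps_of_poly Q * Abs_fps a
        = fps_of_poly P * (inverse (fps_of_poly Q) * fps_of_poly Q)"
      by (simp only: fps_divide_unit[OF unit] ac_simps)
    then show "fps_of_poly Q * Abs_fps a = fps_of_poly P"
      by (simp only: inverse_mult_eq_1[OF unit] mult_1_right)
  qed
  also have "\<dots> \<longleftrightarrow> a = fps_nth (fps_of_poly P / fps_of_poly Q)"
    by (auto simp: fps_eq_iff)
  finally show ?thesis .
qed

lemma recurrence_solved_for_newest_term:
  assumes "coeff Q 0 \<noteq> 0"
  shows "(\<Sum>j\<le>d. coeff Q j * zero_ext a (int n - int j)) = p \<longleftrightarrow>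
    a n = 1 / coeff Q 0 * (p - (\<Sum>j=1..d. coeff Q j * zero_ext a (int n - int j)))"
proof -
  have "(\<Sum>j\<le>d. coeff Q j * zero_ext a (int n - int j))
      = coeff Q 0 * a n + (\<Sum>j=1..d. coeff Q j * zero_ext a (int n - int j))"
    using sum.atLeast_Suc_atMost[of 0 d "\<lambda>j. coeff Q j * zero_ext a (int n - int j)"]
    by (simp add: atLeast0AtMost zero_ext_def)
  then show ?thesis
    using assms by (auto simp: field_simps)
qed

theorem theorem4p1:
  fixes X :: "real^2 \<Rightarrow> real^2" and e :: "real^2" and r m d :: nat
    and P Q :: "real poly" and g c :: "nat \<Rightarrow> real"
  assumes field: "nilpotent_planar_field r X"
    and gen: "kernel_generator X e"
    and deg_P: "degree P \<le> m"
    and deg_Q: "degree Q \<le> d"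
    and Q0: "coeff Q 0 \<noteq> 0"
    and rational: "\<forall>\<^sub>F u in nhds 0.
           distinguished_restriction X e u = u\<^sup>2 * (poly P u / poly Q u)"
    and g: "\<And>k. g k = taylor_coeff (distinguished_restriction X e) k"
    and c: "\<And>n. g (n + 2) = c n"
  shows
    "(g 0 = 0 \<and> g 1 = 0 \<and>
      (\<forall>\<^sub>F u in nhds 0.
         (\<lambda>k. g k * u ^ k) sums distinguished_restriction X e u \<and>
         summable (\<lambda>n. c n * u ^ n) \<and>
         distinguished_restriction X e u = u\<^sup>2 * (\<Sum>n. c n * u ^ n)))
     \<and> (\<forall>n. (\<Sum>j\<le>d. coeff Q j * zero_ext c (int n - int j)) = coeff P n)
     \<and> (\<forall>n. c n = 1 / coeff Q 0 *
           (coeff P n - (\<Sum>j=1..d. coeff Q j * zero_ext c (int n - int j))))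
     \<and> (\<forall>a n. (\<Sum>j\<le>d. coeff Q j * zero_ext a (int n - int j)) = coeff P n \<longleftrightarrow>
           a n = 1 / coeff Q 0 *
             (coeff P n - (\<Sum>j=1..d. coeff Q j * zero_ext a (int n - int j))))
     \<and> (\<forall>a. (\<forall>n. (\<Sum>j\<le>d. coeff Q j * zero_ext a (int n - int j)) = coeff P n) \<longleftrightarrow> a = c)
     \<and> (\<forall>n>m. (\<Sum>j\<le>d. coeff Q j * zero_ext c (int n - int j)) = 0)
     \<and> (\<forall>s Y f. nilpotent_planar_field s Y \<longrightarrow> kernel_generator Y f \<longrightarrow>
          (\<forall>\<^sub>F u in nhds 0.
             distinguished_restriction Y f u = u\<^sup>2 * (poly P u / poly Q u)) \<longrightarrow>
          (\<forall>k. taylor_coeff (distinguished_restriction Y f) k = g k))"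
proof -
  define C where "C = fps_of_poly P / fps_of_poly Q"
  have expansion: "R has_fps_expansion fps_X ^ 2 * C"
    if "\<forall>\<^sub>F u in nhds 0. R u = u\<^sup>2 * (poly P u / poly Q u)" for R
    unfolding C_def
    by (rule has_fps_expansion_cong_ev[OF has_fps_expansion_mult[OF
          has_fps_expansion_fps_X_power has_fps_expansion_rational[OF Q0]] that])
  have g_nth: "g k = fps_nth (fps_X ^ 2 * C) k" for k
    using taylor_coeff_eq_fps_nth[OF expansion[OF rational]] g by simp
  have c_nth: "c = fps_nth C"
    by (rule ext) (simp add: c[symmetric] g_nth fps_X_power_mult_nth)
  have low: "g 0 = 0 \<and> g 1 = 0"
    by (simp add: g_nth fps_X_power_mult_nth)
  have series: "\<forall>\<^sub>F u in nhds 0.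
      (\<lambda>k. g k * u ^ k) sums distinguished_restriction X e u \<and>
      summable (\<lambda>n. c n * u ^ n) \<and>
      distinguished_restriction X e u = u\<^sup>2 * (\<Sum>n. c n * u ^ n)"
    using has_fps_expansion_sums[OF expansion[OF rational]]
      has_fps_expansion_sums[OF has_fps_expansion_rational[OF Q0, of P]] rational
  proof eventually_elim
    case (elim u)
    then show ?case
      by (simp add: g_nth c_nth C_def sums_iff)
  qed
  have unique: "(\<forall>n. (\<Sum>j\<le>d. coeff Q j * zero_ext a (int n - int j)) = coeff P n) \<longleftrightarrow> a = c"
    for a
    using recurrence_iff_generating_fps[OF deg_Q Q0] by (simp add: c_nth C_def)
  then have rec: "(\<Sum>j\<le>d. coeff Q j * zero_ext c (int n - int j)) = coeff P n" for n
    by blast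
  have solved: "(\<Sum>j\<le>d. coeff Q j * zero_ext a (int n - int j)) = coeff P n \<longleftrightarrow>
      a n = 1 / coeff Q 0 *
        (coeff P n - (\<Sum>j=1..d. coeff Q j * zero_ext a (int n - int j)))" for a n
    by (rule recurrence_solved_for_newest_term[OF Q0])
  have homogeneous: "(\<Sum>j\<le>d. coeff Q j * zero_ext c (int n - int j)) = 0" if "n > m" for n
    using rec that deg_P by (simp add: coeff_eq_0)
  have determined: "taylor_coeff (distinguished_restriction Y f) k = g k"
    if "\<forall>\<^sub>F u in nhds 0. distinguished_restriction Y f u = u\<^sup>2 * (poly P u / poly Q u)" for Y f k
    using taylor_coeff_eq_fps_nth[OF expansion[OF that]] g_nth by simp
  show ?thesis
    by (intro conjI allI impI; (rule low[THEN conjunct1] low[THEN conjunct2] series rec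
          solved[THEN iffD1, OF rec] solved unique homogeneous determined; assumption?))
qed

end
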